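(* Let $(\rho_{\mathfrak g},\rho_V,\vartheta_V,\vartheta_{\mathfrak g})$ be an extreme matched pair of $n$-Lie algebras $\mathfrak g$ and $V$, and let $r:V\to\mathfrak g$ be a linear map. The graph $\mathrm{Gr}(r)=\{r(u)+u\mid u\in V\}$ is an $n$-Lie subalgebra of $\mathfrak g\bowtie V$ if and only if $r$ is a deformation map. In that case $[u_1,\dots,u_n]_r:=H_r(u_1,\dots,u_n)$ is an $n$-Lie bracket on $V$, and, writing $V_r$ for $V$ with this bracket, the map $V_r\to\mathrm{Gr}(r)$, $u\mapsto r(u)+u$, is an $n$-Lie algebra isomorphism.
   Context: $K$ is a field of characteristic zero; vector spaces are over $K$, all maps are linear; $n\ge2$; a hat denotes omission. An $n$-Lie algebra is a vector space with an alternating $n$-linear bracket (an $n$-Lie bracket) satisfying $[z_1,\dots,z_{n-1},[w_1,\dots,w_n]]=\sum_{i=1}^n[w_1,\dots,w_{i-1},[z_1,\dots,z_{n-1},w_i],w_{i+1},\dots,w_n]$. An extreme matched pair is a quadruple of linear maps $\rho_{\mathfrak g}:\bigwedge^{n-1}\mathfrak g\to\mathrm{End}(V)$, $\rho_V:\bigwedge^{n-1}V\to\mathrm{End}(\mathfrak g)$, $\vartheta_V:V\to\mathrm{Hom}(\bigwedge^{n-1}\mathfrak g,\mathfrak g)$, $\vartheta_{\mathfrak g}:\mathfrak g\to\mathrm{Hom}(\bigwedge^{n-1}V,V)$ such that $$\begin{aligned}[x_1+u_1,\dots,x_n+u_n]_{\bowtie}={}&[x_1,\dots,x_n]_{\mathfrak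 g}+\sum_{i=1}^n(-1)^{i-1}\vartheta_V(u_i)(x_1,\dots,\widehat{x_i},\dots,x_n)+\sum_{i=1}^n(-1)^{n-i}\rho_V(u_1,\dots,\widehat{u_i},\dots,u_n)x_i\\&+[u_1,\dots,u_n]_V+\sum_{i=1}^n(-1)^{n-i}\rho_{\mathfrak g}(x_1,\dots,\widehat{x_i},\dots,x_n)u_i+\sum_{i=1}^n(-1)^{n-i}\vartheta_{\mathfrak g}(x_i)(u_1,\dots,\widehat{u_i},\dots,u_n)\end{aligned}$$ is an $n$-Lie bracket on $\mathfrak g\oplus V$; the resulting $n$-Lie algebra is $\mathfrak g\bowtie V$. For linear $r:V\to\mathfrak g$ put $$\begin{aligned}G_r(u_1,\dots,u_n)={}&[r(u_1),\dots,r(u_n)]_{\mathfrak g}+\sum_{i=1}^n(-1)^{i-1}\vartheta_V(u_i)(r(u_1),\dots,\widehat{r(u_i)},\dots,r(u_n))\\&+\sum_{i=1}^n(-1)^{n-i}\rho_V(u_1,\dots,\widehat{u_i},\dots,u_n)r(u_i),\\ H_r(u_1,\dots,u_n)={}&[u_1,\dots,u_n]_V+\sum_{i=1}^n(-1)^{n-i}\rho_{\mathfrak g}(r(u_1),\dots,\widehat{r(u_i)},\dots,r(u_n))u_i\\&+\sum_{i=1}^n(-1)^{n-i}\vartheta_{\mathfrak g}(r(u_i))(u_1,\dots,\widehat{u_i},\dots,u_n).\end{aligned}$$ $r$ is a deformation map if $G_r(u_1,\dots,u_n)=r(H_r(u_1,\dots,u_n))$ for all $u_1,\dots,u_n\in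 V$. *)

theory Defs
  imports "HOL-Analysis.Product_Vector"
begin

text \<open>
  Conventions. The arguments of an \<open>n\<close>-ary operation form a list of length \<open>n\<close>; the values of
  the operation on lists of any other length are irrelevant. List positions are counted from 0, so a
  sign \<open>(-1)^(i-1)\<close> or \<open>(-1)^(n-i)\<close> with \<open>i\<close> counted from 1 becomes \<open>(-1)^i\<close> or \<open>(-1)^(n-1-i)\<close>.
  A linear map on an exterior power is represented by the corresponding alternating multilinear map.
\<close>

definition omit :: "nat \<Rightarrow> 'a list \<Rightarrow> 'a list" where
  "omit i xs = take i xs @ drop (Suc i) xs"

definition multilinear_on ::
  "('k::field \<Rightarrow> 'a::ab_group_add \<Rightarrow> 'a) \<Rightarrow> ('k \<Rightarrow> 'b::ab_group_add \<Rightarrow> 'b) \<Rightarrow>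
     nat \<Rightarrow> 'a set \<Rightarrow> ('a list \<Rightarrow> 'b) \<Rightarrow> bool" where
  "multilinear_on s1 s2 m A f \<longleftrightarrow>
     (\<forall>xs i x y c. length xs = m \<and> set xs \<subseteq> A \<and> i < m \<and> x \<in> A \<and> y \<in> A \<longrightarrow>
        f (xs[i := x + y]) = f (xs[i := x]) + f (xs[i := y]) \<and>
        f (xs[i := s1 c x]) = s2 c (f (xs[i := x])))"

definition alternating_on :: "nat \<Rightarrow> 'a set \<Rightarrow> ('a list \<Rightarrow> 'b::zero) \<Rightarrow> bool" where
  "alternating_on m A f \<longleftrightarrow>
     (\<forall>xs i j. length xs = m \<and> set xs \<subseteq> A \<and> i < j \<and> j < m \<and> xs ! i = xs ! j \<longrightarrow> f xs = 0)"

text \<open>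
  The underlying vector space is a subspace \<open>A\<close> of an ambient one, so that subalgebras are
  \<open>n\<close>-Lie algebras in the same sense as whole types.
\<close>

locale n_Lie_algebra = vector_space scale
  for scale :: "'k::field_char_0 \<Rightarrow> 'a::ab_group_add \<Rightarrow> 'a" +
  fixes n :: nat
    and A :: "'a set"
    and br :: "'a list \<Rightarrow> 'a"
  assumes subspace_carrier: "subspace A"
    and br_closed: "\<lbrakk>length xs = n; set xs \<subseteq> A\<rbrakk> \<Longrightarrow> br xs \<in> A"
    and br_multilinear: "multilinear_on scale scale n A br"
    and br_alternating: "alternating_on n A br"
    and fundamental_identity:
      "\<lbrakk>length zs = n - 1; length ws = n; set zs \<subseteq> A; set ws \<subseteq> A\<rbrakk> \<Longrightarrow>
         br (zs @ [br ws]) = (\<Sum>i<n. br (ws[i := br (zs @ [ws ! i])]))"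

locale n_Lie_subalgebra = n_Lie_algebra scale n A br
  for scale :: "'k::field_char_0 \<Rightarrow> 'a::ab_group_add \<Rightarrow> 'a"
    and n :: nat
    and A :: "'a set"
    and br :: "'a list \<Rightarrow> 'a" +
  fixes B :: "'a set"
  assumes sub_subset: "B \<subseteq> A"
    and sub_subspace: "subspace B"
    and sub_closed: "\<lbrakk>length xs = n; set xs \<subseteq> B\<rbrakk> \<Longrightarrow> br xs \<in> B"

locale n_Lie_isomorphism =
  dom: n_Lie_algebra s1 n A br1 + cod: n_Lie_algebra s2 n B br2
  for n :: nat
    and s1 :: "'k::field_char_0 \<Rightarrow> 'a::ab_group_add \<Rightarrow> 'a"
    and A :: "'a set"
    and br1 :: "'a list \<Rightarrow> 'a"
    and s2 :: "'k \<Rightarrow> 'b::ab_group_add \<Rightarrow> 'b"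
    and B :: "'b set"
    and br2 :: "'b list \<Rightarrow> 'b" +
  fixes f :: "'a \<Rightarrow> 'b"
  assumes bij: "bij_betw f A B"
    and add: "\<lbrakk>x \<in> A; y \<in> A\<rbrakk> \<Longrightarrow> f (x + y) = f x + f y"
    and scale: "x \<in> A \<Longrightarrow> f (s1 c x) = s2 c (f x)"
    and bracket: "\<lbrakk>length xs = n; set xs \<subseteq> A\<rbrakk> \<Longrightarrow> f (br1 xs) = br2 (map f xs)"

text \<open>The direct sum of two spaces is the product type; \<open>x + u\<close> is the pair \<open>(x, u)\<close>.\<close>

definition bowtie_bracket ::
  "nat \<Rightarrow> ('k::field_char_0 \<Rightarrow> 'g::ab_group_add \<Rightarrow> 'g) \<Rightarrow> ('k \<Rightarrow> 'v::ab_group_add \<Rightarrow> 'v) \<Rightarrow>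
     ('g list \<Rightarrow> 'g) \<Rightarrow> ('v list \<Rightarrow> 'v) \<Rightarrow>
     ('g list \<Rightarrow> 'v \<Rightarrow> 'v) \<Rightarrow> ('v list \<Rightarrow> 'g \<Rightarrow> 'g) \<Rightarrow>
     ('v \<Rightarrow> 'g list \<Rightarrow> 'g) \<Rightarrow> ('g \<Rightarrow> 'v list \<Rightarrow> 'v) \<Rightarrow>
     ('g \<times> 'v) list \<Rightarrow> 'g \<times> 'v" where
  "bowtie_bracket n sg sv brg brv \<rho>g \<rho>v \<theta>v \<theta>g ps =
     (let xs = map fst ps; us = map snd ps in
       (brg xs
          + (\<Sum>i<n. sg ((-1) ^ i) (\<theta>v (us ! i) (omit i xs)))
          + (\<Sum>i<n. sg ((-1) ^ (n - 1 - i)) (\<rho>v (omit i us) (xs ! i))),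
        brv us
          + (\<Sum>i<n. sv ((-1) ^ (n - 1 - i)) (\<rho>g (omit i xs) (us ! i)))
          + (\<Sum>i<n. sv ((-1) ^ (n - 1 - i)) (\<theta>g (xs ! i) (omit i us)))))"

locale extreme_matched_pair =
  g: n_Lie_algebra sg n UNIV brg + V: n_Lie_algebra sv n UNIV brv
  for n :: nat
    and sg :: "'k::field_char_0 \<Rightarrow> 'g::ab_group_add \<Rightarrow> 'g"
    and sv :: "'k \<Rightarrow> 'v::ab_group_add \<Rightarrow> 'v"
    and brg :: "'g list \<Rightarrow> 'g"
    and brv :: "'v list \<Rightarrow> 'v" +
  fixes \<rho>g :: "'g list \<Rightarrow> 'v \<Rightarrow> 'v"
    and \<rho>v :: "'v list \<Rightarrow> 'g \<Rightarrow> 'g"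
    and \<theta>v :: "'v \<Rightarrow> 'g list \<Rightarrow> 'g"
    and \<theta>g :: "'g \<Rightarrow> 'v list \<Rightarrow> 'v"
  assumes \<rho>g_multilinear: "multilinear_on sg sv (n - 1) UNIV (\<lambda>xs. \<rho>g xs u)"
    and \<rho>g_alternating: "alternating_on (n - 1) UNIV (\<lambda>xs. \<rho>g xs u)"
    and \<rho>g_linear: "length xs = n - 1 \<Longrightarrow> Vector_Spaces.linear sv sv (\<rho>g xs)"
    and \<rho>v_multilinear: "multilinear_on sv sg (n - 1) UNIV (\<lambda>us. \<rho>v us x)"
    and \<rho>v_alternating: "alternating_on (n - 1) UNIV (\<lambda>us. \<rho>v us x)"
    and \<rho>v_linear: "length us = n - 1 \<Longrightarrow> Vector_Spaces.linear sg sg (\<rho>v us)"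
    and \<theta>v_multilinear: "multilinear_on sg sg (n - 1) UNIV (\<theta>v u)"
    and \<theta>v_alternating: "alternating_on (n - 1) UNIV (\<theta>v u)"
    and \<theta>v_linear: "length xs = n - 1 \<Longrightarrow> Vector_Spaces.linear sv sg (\<lambda>u. \<theta>v u xs)"
    and \<theta>g_multilinear: "multilinear_on sv sv (n - 1) UNIV (\<theta>g x)"
    and \<theta>g_alternating: "alternating_on (n - 1) UNIV (\<theta>g x)"
    and \<theta>g_linear: "length us = n - 1 \<Longrightarrow> Vector_Spaces.linear sg sv (\<lambda>x. \<theta>g x us)"
    and bowtie: "n_Lie_algebra (module_prod.scale sg sv) n UNIV
                   (bowtie_bracket n sg sv brg brv \<rho>g \<rho>v \<theta>v \<theta>g)"

definition G_map ::
  "nat \<Rightarrow> ('k::field_char_0 \<Rightarrow> 'g::ab_group_add \<Rightarrow> 'g) \<Rightarrow> ('g list \<Rightarrow> 'g) \<Rightarrow>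
     ('v list \<Rightarrow> 'g \<Rightarrow> 'g) \<Rightarrow> ('v \<Rightarrow> 'g list \<Rightarrow> 'g) \<Rightarrow> ('v \<Rightarrow> 'g) \<Rightarrow> 'v list \<Rightarrow> 'g" where
  "G_map n sg brg \<rho>v \<theta>v r us =
     brg (map r us)
       + (\<Sum>i<n. sg ((-1) ^ i) (\<theta>v (us ! i) (omit i (map r us))))
       + (\<Sum>i<n. sg ((-1) ^ (n - 1 - i)) (\<rho>v (omit i us) (r (us ! i))))"

definition H_map ::
  "nat \<Rightarrow> ('k::field_char_0 \<Rightarrow> 'v::ab_group_add \<Rightarrow> 'v) \<Rightarrow> ('v list \<Rightarrow> 'v) \<Rightarrow>
     ('g list \<Rightarrow> 'v \<Rightarrow> 'v) \<Rightarrow> ('g \<Rightarrow> 'v list \<Rightarrow> 'v) \<Rightarrow> ('v \<Rightarrow> 'g) \<Rightarrow> 'v list \<Rightarrow> 'v" where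
  "H_map n sv brv \<rho>g \<theta>g r us =
     brv us
       + (\<Sum>i<n. sv ((-1) ^ (n - 1 - i)) (\<rho>g (omit i (map r us)) (us ! i)))
       + (\<Sum>i<n. sv ((-1) ^ (n - 1 - i)) (\<theta>g (r (us ! i)) (omit i us)))"

definition deformation_map ::
  "nat \<Rightarrow> ('k::field_char_0 \<Rightarrow> 'g::ab_group_add \<Rightarrow> 'g) \<Rightarrow> ('k \<Rightarrow> 'v::ab_group_add \<Rightarrow> 'v) \<Rightarrow>
     ('g list \<Rightarrow> 'g) \<Rightarrow> ('v list \<Rightarrow> 'v) \<Rightarrow>
     ('g list \<Rightarrow> 'v \<Rightarrow> 'v) \<Rightarrow> ('v list \<Rightarrow> 'g \<Rightarrow> 'g) \<Rightarrow>
     ('v \<Rightarrow> 'g list \<Rightarrow> 'g) \<Rightarrow> ('g \<Rightarrow> 'v list \<Rightarrow> 'v) \<Rightarrow> ('v \<Rightarrow> 'g) \<Rightarrow> bool" where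
  "deformation_map n sg sv brg brv \<rho>g \<rho>v \<theta>v \<theta>g r \<longleftrightarrow>
     Vector_Spaces.linear sv sg r \<and>
     (\<forall>us. length us = n \<longrightarrow>
        G_map n sg brg \<rho>v \<theta>v r us = r (H_map n sv brv \<rho>g \<theta>g r us))"

definition Gr :: "('v \<Rightarrow> 'g) \<Rightarrow> ('g \<times> 'v) set" where
  "Gr r = {(r u, u) | u. True}"

end

theory Submission
  imports Defs
begin

text \<open>
  The bracket of \<open>\<gg> \<bowtie> V\<close> evaluated at the graph points \<open>r(u\<^sub>i) + u\<^sub>i\<close> has \<open>\<gg>\<close>-component
  \<open>G\<^sub>r(u\<^sub>1, \<dots>, u\<^sub>n)\<close> and \<open>V\<close>-component \<open>H\<^sub>r(u\<^sub>1, \<dots>, u\<^sub>n)\<close> (\<open>bowtie_bracket_graph\<close>); that is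
  how \<open>G\<^sub>r\<close> and \<open>H\<^sub>r\<close> arise. A pair \<open>(x, u)\<close> is on the graph exactly when \<open>x = r(u)\<close>, so
  the bracket of the graph points stays on the graph exactly when \<open>G\<^sub>r = r \<circ> H\<^sub>r\<close>. Linearity of
  \<open>r\<close> makes the graph a subspace, whence the equivalence.

  If \<open>r\<close> is a deformation map, the same computation says that the linear bijection
  \<open>u \<mapsto> r(u) + u\<close> from \<open>V\<close> to the graph carries \<open>H\<^sub>r\<close> to the bracket of the subalgebra. The axioms of
  an \<open>n\<close>-Lie algebra are therefore pulled back to \<open>H\<^sub>r\<close> along this bijection
  (\<open>n_Lie_isomorphism_transport\<close>), without any computation with the four structure maps.
\<close>

lemma (in n_Lie_subalgebra) n_Lie_algebra_restrict: "n_Lie_algebra scale n B br"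
proof
  show "multilinear_on scale scale n B br"
    unfolding multilinear_on_def
  proof (intro allI impI)
    fix xs i x y c
    assume "length xs = n \<and> set xs \<subseteq> B \<and> i < n \<and> x \<in> B \<and> y \<in> B"
    then have "length xs = n \<and> set xs \<subseteq> A \<and> i < n \<and> x \<in> A \<and> y \<in> A"
      using sub_subset by auto
    then show "br (xs[i := x + y]) = br (xs[i := x]) + br (xs[i := y]) \<and>
        br (xs[i := scale c x]) = scale c (br (xs[i := x]))"
      using br_multilinear unfolding multilinear_on_def by blast
  qed
  show "alternating_on n B br"
    using br_alternating order_trans[OF _ sub_subset] unfolding alternating_on_def by blast
qed (use sub_subset sub_subspace sub_closed fundamental_identity in auto)

text \<open>
  Each axiom of \<open>br1\<close> is an equation between elements of \<open>A\<close>, and \<open>f\<close> turns it into the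
  same axiom of \<open>br2\<close>; injectivity of \<open>f\<close> on \<open>A\<close> brings it back. For \<open>n = 0\<close> the fundamental
  identity would evaluate the brackets on lists of length 1, where \<open>f\<close> does not relate them.
\<close>

lemma n_Lie_isomorphism_transport:
  fixes s1 :: "'k::field_char_0 \<Rightarrow> 'a::ab_group_add \<Rightarrow> 'a"
    and s2 :: "'k \<Rightarrow> 'b::ab_group_add \<Rightarrow> 'b"
  assumes "n > 0"
    and dom: "vector_space s1" "module.subspace s1 A"
    and closed: "\<And>xs. length xs = n \<Longrightarrow> set xs \<subseteq> A \<Longrightarrow> br1 xs \<in> A"
    and cod: "n_Lie_algebra s2 n B br2"
    and bij: "bij_betw f A B"
    and add: "\<And>x y. x \<in> A \<Longrightarrow> y \<in> A \<Longrightarrow> f (x + y) = f x + f y"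
    and scale: "\<And>c x. x \<in> A \<Longrightarrow> f (s1 c x) = s2 c (f x)"
    and bracket: "\<And>xs. length xs = n \<Longrightarrow> set xs \<subseteq> A \<Longrightarrow> f (br1 xs) = br2 (map f xs)"
  shows "n_Lie_isomorphism n s1 A br1 s2 B br2 f"
proof -
  interpret D: vector_space s1 by (rule dom)
  interpret C: n_Lie_algebra s2 n B br2 by (rule cod)
  have sub: "D.subspace A" by (rule dom)
  have img: "f x \<in> B" if "x \<in> A" for x
    using bij that by (auto simp: bij_betw_def)
  have inj: "x = y" if "f x = f y" "x \<in> A" "y \<in> A" for x y
    using bij that by (auto simp: bij_betw_def inj_on_def)
  have imgs: "set (map f xs) \<subseteq> B" if "set xs \<subseteq> A" for xs
    using that img by auto
  have upd: "set (xs[i := x]) \<subseteq> A" if "set xs \<subseteq> A" "x \<in> A" for xs i x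
    using that set_update_subset_insert[of xs i x] by blast
  have zero: "f 0 = 0"
    using add[of 0 0] D.subspace_0[OF sub] by simp
  have f_sum: "f (\<Sum>i\<in>I. g i) = (\<Sum>i\<in>I. f (g i))"
    if "finite I" "\<And>i. i \<in> I \<Longrightarrow> g i \<in> A" for I :: "nat set" and g
    using that
  proof (induction I rule: finite_induct)
    case (insert i I)
    then have "(\<Sum>i\<in>I. g i) \<in> A"
      by (intro D.subspace_sum[OF sub]) auto
    then show ?case
      using insert by (simp add: add)
  qed (simp add: zero)
  have "n_Lie_algebra s1 n A br1"
  proof
    show "D.subspace A" by (rule sub)
  next
    fix xs assume "length xs = n" "set xs \<subseteq> A"
    then show "br1 xs \<in> A" by (rule closed)
  next
    show "multilinear_on s1 s1 n A br1"
      unfolding multilinear_on_def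
    proof (intro allI impI)
      fix xs i x y c
      assume *: "length xs = n \<and> set xs \<subseteq> A \<and> i < n \<and> x \<in> A \<and> y \<in> A"
      have f_upd: "f (br1 (xs[i := z])) = br2 ((map f xs)[i := f z])" if "z \<in> A" for z
        using * that by (simp add: bracket upd map_update)
      have A_upd: "br1 (xs[i := z]) \<in> A" if "z \<in> A" for z
        using * that by (simp add: closed upd)
      have xy: "x + y \<in> A" and cx: "s1 c x \<in> A"
        using * D.subspace_add[OF sub] D.subspace_scale[OF sub] by auto
      have lin: "br2 ((map f xs)[i := f x + f y])
            = br2 ((map f xs)[i := f x]) + br2 ((map f xs)[i := f y])"
          "br2 ((map f xs)[i := s2 c (f x)]) = s2 c (br2 ((map f xs)[i := f x]))"
        using C.br_multilinear[unfolded multilinear_on_def, rule_format, of "map f xs" i "f x" "f y" c]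
          * imgs[of xs] img by simp_all
      show "br1 (xs[i := x + y]) = br1 (xs[i := x]) + br1 (xs[i := y]) \<and>
            br1 (xs[i := s1 c x]) = s1 c (br1 (xs[i := x]))"
        using * lin xy cx
        by (auto intro!: inj D.subspace_add[OF sub] D.subspace_scale[OF sub]
            simp: f_upd A_upd add scale)
    qed
  next
    show "alternating_on n A br1"
      unfolding alternating_on_def
    proof (intro allI impI)
      fix xs i j
      assume *: "length xs = n \<and> set xs \<subseteq> A \<and> i < j \<and> j < n \<and> xs ! i = xs ! j"
      then have "map f xs ! i = map f xs ! j" by simp
      then have "br2 (map f xs) = 0"
        using C.br_alternating[unfolded alternating_on_def, rule_format, of "map f xs" i j]
          * imgs[of xs] by simp
      then show "br1 xs = 0"
        using * by (intro inj) (simp_all add: bracket zero closed D.subspace_0[OF sub])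
    qed
  next
    fix zs ws
    assume *: "length zs = n - 1" "length ws = n" "set zs \<subseteq> A" "set ws \<subseteq> A"
    have snoc: "br1 (zs @ [w]) \<in> A" "f (br1 (zs @ [w])) = br2 (map f zs @ [f w])"
      if "w \<in> A" for w
      using * that \<open>n > 0\<close> by (simp_all add: closed bracket)
    have summand: "br1 (ws[i := br1 (zs @ [ws ! i])]) \<in> A"
      "f (br1 (ws[i := br1 (zs @ [ws ! i])]))
        = br2 ((map f ws)[i := br2 (map f zs @ [map f ws ! i])])" if "i < n" for i
    proof -
      have "ws ! i \<in> A" using * that by auto
      then show "br1 (ws[i := br1 (zs @ [ws ! i])]) \<in> A"
        "f (br1 (ws[i := br1 (zs @ [ws ! i])]))
          = br2 ((map f ws)[i := br2 (map f zs @ [map f ws ! i])])"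
        using * that by (simp_all add: closed bracket upd map_update snoc)
    qed
    show "br1 (zs @ [br1 ws]) = (\<Sum>i<n. br1 (ws[i := br1 (zs @ [ws ! i])]))"
    proof (rule inj)
      have "f (br1 (zs @ [br1 ws])) = br2 (map f zs @ [br2 (map f ws)])"
        using * by (simp add: snoc closed bracket)
      also have "\<dots> = (\<Sum>i<n. br2 ((map f ws)[i := br2 (map f zs @ [map f ws ! i])]))"
        using * imgs by (intro C.fundamental_identity) simp_all
      also have "\<dots> = f (\<Sum>i<n. br1 (ws[i := br1 (zs @ [ws ! i])]))"
        by (subst f_sum) (auto simp del: nth_map simp: summand intro!: sum.cong)
      finally show "f (br1 (zs @ [br1 ws])) = f (\<Sum>i<n. br1 (ws[i := br1 (zs @ [ws ! i])]))" .
      show "br1 (zs @ [br1 ws]) \<in> A"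
        using * by (simp add: snoc closed)
      show "(\<Sum>i<n. br1 (ws[i := br1 (zs @ [ws ! i])])) \<in> A"
        by (intro D.subspace_sum[OF sub]) (simp add: summand)
    qed
  qed
  then interpret n_Lie_algebra s1 n A br1 .
  show ?thesis
    by unfold_locales (use bij add scale bracket in auto)
qed

lemma bowtie_bracket_graph:
  assumes "length us = n"
  shows "bowtie_bracket n sg sv brg brv \<rho>g \<rho>v \<theta>v \<theta>g (map (\<lambda>u. (r u, u)) us)
    = (G_map n sg brg \<rho>v \<theta>v r us, H_map n sv brv \<rho>g \<theta>g r us)"
  using assms by (simp add: bowtie_bracket_def G_map_def H_map_def Let_def comp_def)

lemma set_subset_Gr_iff: "set ps \<subseteq> Gr r \<longleftrightarrow> (\<exists>us. ps = map (\<lambda>u. (r u, u)) us)"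
proof -
  have "Gr r = range (\<lambda>u. (r u, u))"
    by (auto simp: Gr_def)
  then show ?thesis
    using ex_map_conv[of ps "\<lambda>u. (r u, u)"] by auto
qed

theorem theorem7p2:
  fixes n :: nat
    and sg :: "'k::field_char_0 \<Rightarrow> 'g::ab_group_add \<Rightarrow> 'g"
    and sv :: "'k \<Rightarrow> 'v::ab_group_add \<Rightarrow> 'v"
    and brg :: "'g list \<Rightarrow> 'g" and brv :: "'v list \<Rightarrow> 'v"
    and \<rho>g :: "'g list \<Rightarrow> 'v \<Rightarrow> 'v" and \<rho>v :: "'v list \<Rightarrow> 'g \<Rightarrow> 'g"
    and \<theta>v :: "'v \<Rightarrow> 'g list \<Rightarrow> 'g" and \<theta>g :: "'g \<Rightarrow> 'v list \<Rightarrow> 'v"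
    and r :: "'v \<Rightarrow> 'g"
  assumes "n \<ge> 2"
    and "extreme_matched_pair n sg sv brg brv \<rho>g \<rho>v \<theta>v \<theta>g"
    and "Vector_Spaces.linear sv sg r"
  shows
    "(n_Lie_subalgebra (module_prod.scale sg sv) n UNIV
        (bowtie_bracket n sg sv brg brv \<rho>g \<rho>v \<theta>v \<theta>g) (Gr r)
      \<longleftrightarrow> deformation_map n sg sv brg brv \<rho>g \<rho>v \<theta>v \<theta>g r) \<and>
     (deformation_map n sg sv brg brv \<rho>g \<rho>v \<theta>v \<theta>g r \<longrightarrow>
        n_Lie_algebra sv n UNIV (H_map n sv brv \<rho>g \<theta>g r) \<and>
        n_Lie_isomorphism n sv UNIV (H_map n sv brv \<rho>g \<theta>g r)
          (module_prod.scale sg sv) (Gr r) (bowtie_bracket n sg sv brg brv \<rho>g \<rho>v \<theta>v \<theta>g)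
          (\<lambda>u. (r u, u)))"
proof -
  let ?s = "module_prod.scale sg sv"
  let ?b = "bowtie_bracket n sg sv brg brv \<rho>g \<rho>v \<theta>v \<theta>g"
  let ?G = "G_map n sg brg \<rho>v \<theta>v r"
  let ?H = "H_map n sv brv \<rho>g \<theta>g r"
  let ?\<phi> = "\<lambda>u. (r u, u)"
  interpret extreme_matched_pair n sg sv brg brv \<rho>g \<rho>v \<theta>v \<theta>g by fact
  interpret r: Vector_Spaces.linear sv sg r by fact
  interpret B: n_Lie_algebra ?s n UNIV ?b by (rule bowtie)
  interpret P: module_prod sg sv ..
  have subspace_Gr: "B.subspace (Gr r)"
    by (rule B.subspaceI) (auto simp: Gr_def zero_prod_def P.scale_prod r.add r.scale r.zero)
  have subalgebra_iff: "n_Lie_subalgebra ?s n UNIV ?b (Gr r)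
      \<longleftrightarrow> (\<forall>us. length us = n \<longrightarrow> ?b (map ?\<phi> us) \<in> Gr r)"
  proof
    assume "n_Lie_subalgebra ?s n UNIV ?b (Gr r)"
    then interpret sub: n_Lie_subalgebra ?s n UNIV ?b "Gr r" .
    show "\<forall>us. length us = n \<longrightarrow> ?b (map ?\<phi> us) \<in> Gr r"
      by (intro allI impI sub.sub_closed) (auto simp: Gr_def)
  next
    assume "\<forall>us. length us = n \<longrightarrow> ?b (map ?\<phi> us) \<in> Gr r"
    then show "n_Lie_subalgebra ?s n UNIV ?b (Gr r)"
      by unfold_locales (auto simp: subspace_Gr set_subset_Gr_iff)
  qed
  also have "\<dots> \<longleftrightarrow> deformation_map n sg sv brg brv \<rho>g \<rho>v \<theta>v \<theta>g r"
    using r.linear_axioms by (simp add: bowtie_bracket_graph deformation_map_def Gr_def)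
  finally have iff: "n_Lie_subalgebra ?s n UNIV ?b (Gr r)
      \<longleftrightarrow> deformation_map n sg sv brg brv \<rho>g \<rho>v \<theta>v \<theta>g r" .
  have iso: "n_Lie_isomorphism n sv UNIV ?H ?s (Gr r) ?b ?\<phi>"
    if def: "deformation_map n sg sv brg brv \<rho>g \<rho>v \<theta>v \<theta>g r"
  proof (rule n_Lie_isomorphism_transport)
    show "n_Lie_algebra ?s n (Gr r) ?b"
      using iff def by (blast intro: n_Lie_subalgebra.n_Lie_algebra_restrict)
    show "bij_betw ?\<phi> UNIV (Gr r)"
      by (auto simp: bij_betw_def inj_on_def Gr_def)
    show "?\<phi> (?H us) = ?b (map ?\<phi> us)" if "length us = n" for us
      using def that by (simp add: bowtie_bracket_graph deformation_map_def)
  qed (use \<open>n \<ge> 2\<close> V.vector_space_axioms V.subspace_carrier in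
      \<open>auto simp: r.add r.scale P.scale_prod\<close>)
  show ?thesis
    using iff iso by (blast dest: n_Lie_isomorphism.axioms(1))
qed

end
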